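(* Let $n\ge p\ge 1$ be integers, let $B\in\mathbb{R}^{n\times n}$ be symmetric, and let $G\in\mathbb{R}^{p\times p}$ and $A\in\mathbb{R}^{n\times n}$ be symmetric positive definite. Consider the problem (GRS) $$\sup_{X\in\mathbb{R}^{n\times p},\,X\ne0}\ \frac{\mathrm{tr}(GX^TBX)}{\mathrm{tr}(GX^TAX)}\quad\text{s.t.}\quad \frac{X^TX}{\mathrm{tr}(GX^TAX)}=\frac{I_p}{\mathrm{tr}(GX^TAX)},\quad \frac{XX^T}{\mathrm{tr}(GX^TAX)}\preceq\frac{I_n}{\mathrm{tr}(GX^TAX)}.$$ Then there is no Lagrangian duality gap for (GRS); that is, the optimal value of (GRS) equals the optimal value of its Lagrangian dual $$\inf_{M,\,W\succeq0}\ \sup_{X\in\mathbb{R}^{n\times p},\,X\neq 0}\ \frac{\mathrm{tr}(GX^TBX)-\mathrm{tr}\big(M(X^TX-I_p)\big)+\mathrm{tr}\big(W(I_n-XX^T)\big)}{\mathrm{tr}(GX^TAX)},$$ where the infimum is over all symmetric $M\in\mathbb{R}^{p\times p}$ and all symmetric positive semidefinite $W\in\mathbb{R}^{n\times n}$.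
   Context: $I_k$ denotes the $k\times k$ identity matrix. For symmetric matrices, $P\preceq R$ means that $R-P$ is positive semidefinite. The supremum defining the dual function may be $+\infty$ for some $(M,W)$. *)

theory Defs
  imports "HOL-Analysis.Analysis"
begin

definition sym_mat :: "real^'k^'k \<Rightarrow> bool" where
  "sym_mat A \<longleftrightarrow> transpose A = A"

definition psd_mat :: "real^'k^'k \<Rightarrow> bool" where
  "psd_mat A \<longleftrightarrow> sym_mat A \<and> (\<forall>x. 0 \<le> x \<bullet> (A *v x))"

definition pd_mat :: "real^'k^'k \<Rightarrow> bool" where
  "pd_mat A \<longleftrightarrow> sym_mat A \<and> (\<forall>x. x \<noteq> 0 \<longrightarrow> 0 < x \<bullet> (A *v x))"

definition loewner_le :: "real^'k^'k \<Rightarrow> real^'k^'k \<Rightarrow> bool" where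
  "loewner_le P R \<longleftrightarrow> psd_mat (R - P)"

text \<open>The type \<open>real^'p^'n\<close> consists of the matrices with \<open>CARD('n)\<close> rows and \<open>CARD('p)\<close> columns.\<close>

definition trace_form :: "real^'p^'p \<Rightarrow> real^'n^'n \<Rightarrow> real^'p^'n \<Rightarrow> real" where
  "trace_form G A X = trace (G ** transpose X ** A ** X)"

definition grs_feasible :: "real^'p^'p \<Rightarrow> real^'n^'n \<Rightarrow> (real^'p^'n) set" where
  "grs_feasible G A = {X. X \<noteq> 0 \<and>
     (1 / trace_form G A X) *\<^sub>R (transpose X ** X) = (1 / trace_form G A X) *\<^sub>R mat 1 \<and>
     loewner_le ((1 / trace_form G A X) *\<^sub>R (X ** transpose X))
       ((1 / trace_form G A X) *\<^sub>R mat 1)}"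

text \<open>Optimal values are extended reals, since a dual function value may be \<open>\<infinity>\<close>.\<close>

definition grs_value :: "real^'n^'n \<Rightarrow> real^'p^'p \<Rightarrow> real^'n^'n \<Rightarrow> ereal" where
  "grs_value B G A =
     (SUP X \<in> grs_feasible G A. ereal (trace_form G B X / trace_form G A X))"

definition grs_lagrangian ::
  "real^'n^'n \<Rightarrow> real^'p^'p \<Rightarrow> real^'n^'n \<Rightarrow> real^'p^'p \<Rightarrow> real^'n^'n \<Rightarrow> real^'p^'n \<Rightarrow> real" where
  "grs_lagrangian B G A M W X =
     (trace_form G B X - trace (M ** (transpose X ** X - mat 1))
        + trace (W ** (mat 1 - X ** transpose X))) / trace_form G A X"

definition grs_dual_fun ::
  "real^'n^'n \<Rightarrow> real^'p^'p \<Rightarrow> real^'n^'n \<Rightarrow> real^'p^'p \<Rightarrow> real^'n^'n \<Rightarrow> ereal" where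
  "grs_dual_fun B G A M W = (SUP X \<in> {X. X \<noteq> 0}. ereal (grs_lagrangian B G A M W X))"

definition grs_dual_value :: "real^'n^'n \<Rightarrow> real^'p^'p \<Rightarrow> real^'n^'n \<Rightarrow> ereal" where
  "grs_dual_value B G A =
     (INF (M, W) \<in> {(M, W). sym_mat M \<and> psd_mat W}. grs_dual_fun B G A M W)"

end

(*
  Weak duality holds because the trace of a product of positive semidefinite matrices is
  nonnegative.  For the converse let v be the optimal value, assumed finite.  By homogeneity
  (Dinkelbach), the maximum of tr(G X^T (B - vA) X) over X^T X = I is at most 0.  Expanding in
  eigenbases of G and B - vA turns the Lagrangian dual of this trace problem into the dual of an
  assignment problem with costs g_i * l_j, whose explicit optimal solution (m, w) has w >= 0
  because G is positive definite.  The matrices M and W with eigenvalues m and w then certify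
  that the dual function of (GRS) is at most v.
*)
theory Submission
  imports Defs
begin

section \<open>Orthonormal bases and coordinates\<close>

text \<open>Indexing by naturals lets eigenvalues be sorted and lets bases of spaces of different
  dimension be matched by rank; values from \<open>DIM('a)\<close> on are unconstrained.\<close>

definition orthonormal_seq :: "(nat \<Rightarrow> 'a::euclidean_space) \<Rightarrow> bool" where
  "orthonormal_seq e \<longleftrightarrow>
     (\<forall>i<DIM('a). \<forall>j<DIM('a). e i \<bullet> e j = (if i = j then 1 else 0))"

lemma orthonormal_seqD:
  fixes e :: "nat \<Rightarrow> 'a::euclidean_space"
  assumes "orthonormal_seq e" "i < DIM('a)" "j < DIM('a)"
  shows "e i \<bullet> e j = (if i = j then 1 else 0)"
  using assms unfolding orthonormal_seq_def by blast

lemma inner_sum_orthonormal_seq: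
  fixes e :: "nat \<Rightarrow> 'a::euclidean_space"
  assumes "orthonormal_seq e" "j < DIM('a)"
  shows "(\<Sum>i<DIM('a). c i *\<^sub>R e i) \<bullet> e j = c j"
proof -
  have "(\<Sum>i<DIM('a). c i *\<^sub>R e i) \<bullet> e j = (\<Sum>i<DIM('a). if i = j then c i else 0)"
    unfolding inner_sum_left
    by (rule sum.cong) (auto simp: orthonormal_seqD[OF assms(1) _ assms(2)])
  then show ?thesis using assms(2) by simp
qed

text \<open>\<open>DIM('a)\<close> nonzero orthogonal vectors are independent, hence span; the
  remainder \<open>z\<close> is orthogonal to all of them and so to itself.\<close>

lemma orthonormal_seq_expansion:
  fixes e :: "nat \<Rightarrow> 'a::euclidean_space"
  assumes e: "orthonormal_seq e"
  shows "x = (\<Sum>i<DIM('a). (x \<bullet> e i) *\<^sub>R e i)"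
proof -
  let ?S = "e ` {..<DIM('a)}"
  have inj: "inj_on e {..<DIM('a)}"
    by (rule inj_onI) (metis e lessThan_iff orthonormal_seqD zero_neq_one)
  have "pairwise orthogonal ?S"
    by (auto simp: pairwise_def orthogonal_def orthonormal_seqD[OF e])
  moreover have "0 \<notin> ?S"
    using orthonormal_seqD[OF e] by force
  ultimately have "independent ?S"
    by (rule pairwise_orthogonal_independent)
  then have span: "span ?S = UNIV"
    using card_eq_dim[of ?S UNIV] inj by (auto simp: card_image dim_UNIV)
  define z where "z = x - (\<Sum>i<DIM('a). (x \<bullet> e i) *\<^sub>R e i)"
  have "orthogonal z y" if "y \<in> ?S" for y
    using that by (auto simp: orthogonal_def z_def inner_diff_left inner_sum_orthonormal_seq[OF e])
  then have "orthogonal z z"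
    using orthogonal_to_span[of z ?S z] span by auto
  then show ?thesis
    by (simp add: orthogonal_def z_def)
qed

lemma inner_orthonormal_seq:
  fixes e :: "nat \<Rightarrow> 'a::euclidean_space"
  assumes "orthonormal_seq e"
  shows "x \<bullet> y = (\<Sum>i<DIM('a). (x \<bullet> e i) * (y \<bullet> e i))"
  by (subst orthonormal_seq_expansion[OF assms, of y])
    (simp add: inner_sum_right mult.commute)

lemma orthonormal_seq_eqI:
  fixes e :: "nat \<Rightarrow> 'a::euclidean_space"
  assumes "orthonormal_seq e" "\<And>i. i < DIM('a) \<Longrightarrow> x \<bullet> e i = y \<bullet> e i"
  shows "x = y"
  using assms orthonormal_seq_expansion[of e x] orthonormal_seq_expansion[of e y] by simp

section \<open>Spectral theorem with ordered eigenvalues\<close>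

text \<open>Along \<open>y + t *\<^sub>R x\<close> the form is affine in \<open>t\<close>, so a
  nonzero slope would make it negative somewhere. This replaces differentiation at the maximiser of
  a Rayleigh quotient.\<close>

lemma psd_form_kernel:
  fixes q :: "'a::real_vector \<Rightarrow> 'a \<Rightarrow> real"
  assumes q: "bilinear q" and sym: "\<And>x y. q x y = q y x"
    and S: "subspace S" and nonneg: "\<And>x. x \<in> S \<Longrightarrow> 0 \<le> q x x"
    and x: "x \<in> S" "q x x = 0" and y: "y \<in> S"
  shows "q x y = 0"
proof (rule ccontr)
  assume ne: "q x y \<noteq> 0"
  \<comment> \<open>Chosen so that the form takes the value -1 at
    \<open>y + t *\<^sub>R x\<close>.\<close>
  define t where "t = - (q y y + 1) / (2 * q x y)"
  have "y + t *\<^sub>R x \<in> S"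
    using S x y by (simp add: subspace_add subspace_scale)
  then have "0 \<le> q (y + t *\<^sub>R x) (y + t *\<^sub>R x)"
    by (rule nonneg)
  also have "\<dots> = q y y + 2 * t * q x y"
    using x(2) sym[of y x]
    by (simp add: bilinear_ladd[OF q] bilinear_radd[OF q] bilinear_lmul[OF q] bilinear_rmul[OF q])
  also have "2 * t * q x y = - (q y y + 1)"
    using ne by (simp add: t_def)
  finally show False by simp
qed

text \<open>Maximising the Rayleigh quotient successively on orthogonal complements yields the
  eigenvalues already in decreasing order.\<close>

lemma self_adjoint_partial_eigenbasis:
  fixes f :: "'a::euclidean_space \<Rightarrow> 'a"
  assumes f: "linear f" and sa: "\<And>x y. f x \<bullet> y = x \<bullet> f y" and "k \<le> DIM('a)"
  shows "\<exists>e l. (\<forall>i<k. \<forall>j<k. e i \<bullet> e j = (if i = j then 1 else 0)) \<and>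
           (\<forall>i<k. f (e i) = l i *\<^sub>R e i) \<and> (\<forall>i j. i \<le> j \<longrightarrow> j < k \<longrightarrow> l j \<le> l i) \<and>
           (\<forall>i<k. \<forall>y. (\<forall>j<k. y \<bullet> e j = 0) \<longrightarrow> y \<bullet> f y \<le> l i * (y \<bullet> y))"
  using assms(3)
proof (induction k)
  case 0
  show ?case by simp
next
  case (Suc k)
  then obtain e :: "nat \<Rightarrow> 'a" and l where IH:
      "\<forall>i<k. \<forall>j<k. e i \<bullet> e j = (if i = j then 1 else 0)"
      "\<forall>i<k. f (e i) = l i *\<^sub>R e i" "\<forall>i j. i \<le> j \<longrightarrow> j < k \<longrightarrow> l j \<le> l i"
      "\<forall>i<k. \<forall>y. (\<forall>j<k. y \<bullet> e j = 0) \<longrightarrow> y \<bullet> f y \<le> l i * (y \<bullet> y)"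
    using Suc_leD by blast
  then have on: "\<And>i j. i < k \<Longrightarrow> j < k \<Longrightarrow> e i \<bullet> e j = (if i = j then 1 else 0)"
    and ev: "\<And>i. i < k \<Longrightarrow> f (e i) = l i *\<^sub>R e i"
    and dec: "\<And>i j. i \<le> j \<Longrightarrow> j < k \<Longrightarrow> l j \<le> l i"
    and up: "\<And>i y. i < k \<Longrightarrow> (\<forall>j<k. y \<bullet> e j = 0) \<Longrightarrow> y \<bullet> f y \<le> l i * (y \<bullet> y)"
    by blast+
  define S where "S = {y. \<forall>j<k. y \<bullet> e j = 0}"
  have S: "subspace S"
    by (auto simp: S_def subspace_def inner_add_left)
  have "dim (e ` {..<k}) \<le> card (e ` {..<k})"
    by (rule dim_le_card') simp
  also have "\<dots> \<le> k"
    using card_image_le[of "{..<k}" e] by simp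
  finally have "dim (e ` {..<k}) < DIM('a)"
    using Suc.prems by simp
  \<comment> \<open>Since \<open>k < DIM('a)\<close>, the orthogonal complement \<open>S\<close> is
    nontrivial, so its unit sphere is nonempty and the maximum below exists.\<close>
  then obtain z where z: "z \<noteq> 0" "\<And>y. y \<in> span (e ` {..<k}) \<Longrightarrow> orthogonal z y"
    using orthogonal_to_subspace_exists by blast
  have "z \<in> S"
    using z(2)[OF span_base] by (auto simp: S_def orthogonal_def)
  then have "z /\<^sub>R norm z \<in> S \<inter> sphere 0 1"
    using z(1) S by (simp add: subspace_scale)
  moreover have "compact (S \<inter> sphere 0 1)"
    by (simp add: S closed_subspace closed_Int_compact)
  moreover have "continuous_on (S \<inter> sphere 0 1) (\<lambda>y. y \<bullet> f y)"
    by (intro continuous_intros linear_continuous_on f[unfolded linear_conv_bounded_linear])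
  ultimately obtain u where u: "u \<in> S \<inter> sphere 0 1"
    and umax: "\<And>y. y \<in> S \<inter> sphere 0 1 \<Longrightarrow> y \<bullet> f y \<le> u \<bullet> f u"
    using continuous_attains_sup[of "S \<inter> sphere 0 1" "\<lambda>y. y \<bullet> f y"] by blast
  define m where "m = u \<bullet> f u"
  have uu: "u \<bullet> u = 1" and uS: "u \<in> S"
    using u by (auto simp: norm_eq_1)
  have ray: "y \<bullet> f y \<le> m * (y \<bullet> y)" if "y \<in> S" for y
  proof (cases "y = 0")
    case False
    then have "y /\<^sub>R norm y \<in> S \<inter> sphere 0 1"
      using S that by (simp add: subspace_scale)
    from umax[OF this] False show ?thesis
      by (simp add: m_def linear_scale[OF f] dot_square_norm power2_eq_square field_simps)
  qed (simp add: linear_0[OF f])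
  \<comment> \<open>\<open>S\<close> is invariant because \<open>f\<close> is self-adjoint and the
    vectors cut out by \<open>S\<close> are eigenvectors.\<close>
  have fS: "f y \<in> S" if "y \<in> S" for y
    using that by (simp add: S_def sa ev)
  have bil: "bilinear (\<lambda>x y. m * (x \<bullet> y) - x \<bullet> f y)"
    unfolding bilinear_def
    by (auto intro!: linearI
        simp: inner_add_left inner_add_right linear_add[OF f] linear_scale[OF f] algebra_simps)
  \<comment> \<open>The form \<open>m * (x \<bullet> y) - x \<bullet> f y\<close> is nonnegative on
    \<open>S\<close> and vanishes at \<open>u\<close>, so \<open>u\<close> lies in its kernel;
    pairing \<open>u\<close> with this residual \<open>v\<close> gives
    \<open>v \<bullet> v\<close>.\<close>
  define v where "v = m *\<^sub>R u - f u"
  have "v \<in> S"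
    unfolding v_def using S uS fS by (simp add: subspace_diff subspace_scale)
  have "m * (u \<bullet> v) - u \<bullet> f v = 0"
  proof (rule psd_form_kernel[OF bil _ S _ uS _ \<open>v \<in> S\<close>])
    show "m * (x \<bullet> y) - x \<bullet> f y = m * (y \<bullet> x) - y \<bullet> f x" for x y
      by (metis sa inner_commute)
  qed (simp_all add: ray uu flip: m_def)
  then have "v \<bullet> v = 0"
    by (subst (1) v_def) (simp add: inner_diff_left sa)
  then have fu: "f u = m *\<^sub>R u" by (simp add: v_def)
  define e' where "e' = e(k := u)"
  define l' where "l' = l(k := m)"
  have ue: "u \<bullet> e j = 0" "e j \<bullet> u = 0" if "j < k" for j
    using uS that by (auto simp: S_def inner_commute)
  \<comment> \<open>The last clause of the induction claim serves this step: \<open>u\<close> is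
    orthogonal to the earlier eigenvectors, so their eigenvalues bound its Rayleigh
    quotient.\<close>
  have "m \<le> l i" if "i < k" for i
    using up[OF that, of u] uS uu by (simp add: S_def m_def)
  moreover have "y \<bullet> f y \<le> m * (y \<bullet> y)" "i < k \<Longrightarrow> y \<bullet> f y \<le> l i * (y \<bullet> y)"
    if "\<forall>j<Suc k. y \<bullet> e' j = 0" for i y
  proof -
    have "y \<bullet> e j = 0" if "j < k" for j
      using \<open>\<forall>j<Suc k. y \<bullet> e' j = 0\<close>[rule_format, of j] that by (simp add: e'_def)
    then show "y \<bullet> f y \<le> m * (y \<bullet> y)" "i < k \<Longrightarrow> y \<bullet> f y \<le> l i * (y \<bullet> y)"
      using ray[of y] up[of i y] by (auto simp: S_def)
  qed
  ultimately have "(\<forall>i<Suc k. \<forall>j<Suc k. e' i \<bullet> e' j = (if i = j then 1 else 0)) \<and>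
      (\<forall>i<Suc k. f (e' i) = l' i *\<^sub>R e' i) \<and>
      (\<forall>i j. i \<le> j \<longrightarrow> j < Suc k \<longrightarrow> l' j \<le> l' i) \<and>
      (\<forall>i<Suc k. \<forall>y. (\<forall>j<Suc k. y \<bullet> e' j = 0) \<longrightarrow> y \<bullet> f y \<le> l' i * (y \<bullet> y))"
    by (auto simp: less_Suc_eq l'_def ue uu on ev fu dec) (auto simp: e'_def ue uu on ev fu)
  then show ?case by blast
qed

lemma sym_mat_inner: "sym_mat C \<Longrightarrow> (C *v x) \<bullet> y = x \<bullet> (C *v y)"
  by (metis dot_lmul_matrix sym_mat_def transpose_matrix_vector)

lemma inner_transpose_mult:
  fixes Y :: "real^'p^'n"
  shows "x \<bullet> (transpose Y *v y) = (Y *v x) \<bullet> y"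
  by (metis dot_lmul_matrix inner_commute transpose_matrix_vector)

lemma sym_mat_eigenbasis:
  fixes C :: "real^'n^'n"
  assumes "sym_mat C"
  obtains e :: "nat \<Rightarrow> real^'n" and l where "orthonormal_seq e"
    and "\<And>i. i < CARD('n) \<Longrightarrow> C *v e i = l i *\<^sub>R e i"
    and "\<And>i j. i \<le> j \<Longrightarrow> j < CARD('n) \<Longrightarrow> l j \<le> l i"
  using self_adjoint_partial_eigenbasis[of "(*v) C" "CARD('n)"] sym_mat_inner[OF assms]
  unfolding orthonormal_seq_def by auto

section \<open>Traces and matrices in eigenbases\<close>

text \<open>Expand the standard basis in \<open>e\<close> and swap the sums; the coefficients
  \<open>e i $ k\<close> then reassemble \<open>Q *v e i\<close>.\<close>

lemma trace_orthonormal_seq: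
  fixes Q :: "real^'n^'n"
  assumes e: "orthonormal_seq e"
  shows "trace Q = (\<Sum>i<CARD('n). e i \<bullet> (Q *v e i))"
proof -
  have "trace Q = (\<Sum>k\<in>UNIV. axis k 1 \<bullet> (Q *v axis k 1))"
    by (simp add: trace_def inner_axis' matrix_vector_mult_basis column_def)
  also have "\<dots> = (\<Sum>k\<in>UNIV. \<Sum>i<CARD('n). e i $ k * (e i \<bullet> (Q *v axis k 1)))"
    by (subst inner_orthonormal_seq[OF e]) (simp add: inner_axis inner_commute)
  also have "\<dots> = (\<Sum>i<CARD('n). \<Sum>k\<in>UNIV. e i $ k * (e i \<bullet> (Q *v axis k 1)))"
    by (rule sum.swap)
  also have "\<dots> = (\<Sum>i<CARD('n). e i \<bullet> (Q *v e i))"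
  proof (rule sum.cong[OF refl])
    fix i
    have "Q *v e i = (\<Sum>k\<in>UNIV. e i $ k *\<^sub>R (Q *v axis k 1))"
      by (simp only: matrix_mult_sum[of Q "e i"] matrix_vector_mult_basis scalar_mult_eq_scaleR)
    then show "(\<Sum>k\<in>UNIV. e i $ k * (e i \<bullet> (Q *v axis k 1))) = e i \<bullet> (Q *v e i)"
      by (simp add: inner_sum_right)
  qed
  finally show ?thesis .
qed

lemma trace_eigenbasis:
  fixes M N :: "real^'n^'n"
  assumes "orthonormal_seq e" "\<And>i. i < CARD('n) \<Longrightarrow> M *v e i = m i *\<^sub>R e i"
  shows "trace (M ** N) = (\<Sum>i<CARD('n). m i * (e i \<bullet> (N *v e i)))"
  by (subst trace_mul_sym, subst trace_orthonormal_seq[OF assms(1)])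
    (simp add: assms(2) matrix_vector_mult_scaleR flip: matrix_vector_mul_assoc)

text \<open>Diagonalising \<open>G\<close> alone splits the trace into quadratic forms of
  \<open>C\<close>, which serves both the duality computation and positivity.\<close>

lemma trace_form_eigenbasis:
  fixes G :: "real^'p^'p" and C :: "real^'n^'n"
  assumes "orthonormal_seq f" "\<And>i. i < CARD('p) \<Longrightarrow> G *v f i = g i *\<^sub>R f i"
  shows "trace_form G C X = (\<Sum>i<CARD('p). g i * ((X *v f i) \<bullet> (C *v (X *v f i))))"
proof -
  have "trace_form G C X = trace (G ** (transpose X ** C ** X))"
    by (simp add: trace_form_def matrix_mul_assoc)
  also have "\<dots> = (\<Sum>i<CARD('p). g i * (f i \<bullet> ((transpose X ** C ** X) *v f i)))"
    by (rule trace_eigenbasis[OF assms])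
  also have "\<dots> = (\<Sum>i<CARD('p). g i * ((X *v f i) \<bullet> (C *v (X *v f i))))"
    by (simp add: matrix_vector_mul_assoc[symmetric] inner_transpose_mult
        del: transpose_matrix_vector)
  finally show ?thesis .
qed

lemma ex_matrix_orthonormal_seq:
  fixes f :: "nat \<Rightarrow> real^'p" and v :: "nat \<Rightarrow> real^'n"
  assumes "orthonormal_seq f"
  obtains X where "\<And>i. i < CARD('p) \<Longrightarrow> X *v f i = v i"
proof
  let ?h = "\<lambda>x. \<Sum>j<CARD('p). (x \<bullet> f j) *\<^sub>R v j"
  fix i assume i: "i < CARD('p)"
  have "linear ?h"
    by (auto intro!: linearI simp: inner_add_left scaleR_add_left sum.distrib scaleR_sum_right)
  then have "matrix ?h *v f i = ?h (f i)"
    by (rule fun_cong[OF matrix_vector_mul(2)])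
  also have "\<dots> = (\<Sum>j<CARD('p). if j = i then v j else 0)"
    by (rule sum.cong) (use i in \<open>auto simp: orthonormal_seqD[OF assms]\<close>)
  finally show "matrix ?h *v f i = v i"
    using i by simp
qed

lemma psd_mat_eigenvalue_nonneg:
  assumes "psd_mat M" "M *v x = m *\<^sub>R x" "x \<bullet> x = 1"
  shows "0 \<le> m"
  using assms unfolding psd_mat_def by (metis inner_scaleR_right mult.right_neutral)

text \<open>\<open>M\<close> scales the coordinates in \<open>e\<close>, so symmetry and
  semidefiniteness can be read off there. The latter is conditional because the multiplier of an
  equation may have eigenvalues of any sign.\<close>

lemma ex_mat_eigenvalues:
  fixes e :: "nat \<Rightarrow> real^'n"
  assumes e: "orthonormal_seq e"
  obtains M where "sym_mat M" "\<And>i. i < CARD('n) \<Longrightarrow> M *v e i = m i *\<^sub>R e i"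
    "(\<And>i. i < CARD('n) \<Longrightarrow> 0 \<le> m i) \<Longrightarrow> psd_mat M"
proof -
  obtain M where M: "\<And>i. i < CARD('n) \<Longrightarrow> M *v e i = m i *\<^sub>R e i"
    using ex_matrix_orthonormal_seq[OF e, of "\<lambda>i. m i *\<^sub>R e i"] by blast
  have coord: "(M *v x) \<bullet> e i = m i * (x \<bullet> e i)" if "i < CARD('n)" for x i
  proof -
    have "M *v x = (\<Sum>j<CARD('n). (m j * (x \<bullet> e j)) *\<^sub>R e j)"
      by (subst orthonormal_seq_expansion[OF e, of x])
        (simp add: linear_sum[OF matrix_vector_mul_linear] matrix_vector_mult_scaleR M mult.commute)
    then show ?thesis
      using inner_sum_orthonormal_seq[OF e, of i "\<lambda>j. m j * (x \<bullet> e j)"] that by simp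
  qed
  have "sym_mat M"
    unfolding sym_mat_def
  proof (rule matrix_eq[THEN iffD2], rule allI, rule vector_eq_ldot[THEN iffD1], rule allI)
    fix x y
    have "y \<bullet> (transpose M *v x) = (M *v y) \<bullet> x"
      by (rule inner_transpose_mult)
    also have "\<dots> = y \<bullet> (M *v x)"
      by (simp add: inner_orthonormal_seq[OF e, of "M *v y" x]
          inner_orthonormal_seq[OF e, of y "M *v x"] coord ac_simps)
    finally show "y \<bullet> (transpose M *v x) = y \<bullet> (M *v x)" .
  qed
  moreover have "psd_mat M" if "\<And>i. i < CARD('n) \<Longrightarrow> 0 \<le> m i"
    unfolding psd_mat_def
  proof (intro conjI allI \<open>sym_mat M\<close>)
    fix x
    show "0 \<le> x \<bullet> (M *v x)"
      by (simp add: inner_orthonormal_seq[OF e, of x "M *v x"] coord)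
        (intro sum_nonneg, simp add: that mult.left_commute)
  qed
  ultimately show thesis using that M by blast
qed

section \<open>Assignment duality and the trace problem over orthonormal columns\<close>

text \<open>The optimal dual solution of the assignment problem with product costs, whose optimal
  matching pairs equal ranks: \<open>w\<close> telescopes the decrements of \<open>l\<close> with weights \<open>g\<close>.\<close>

lemma assignment_dual:
  fixes g l :: "nat \<Rightarrow> real"
  assumes "p \<le> n" and g: "\<And>i j. i \<le> j \<Longrightarrow> j < p \<Longrightarrow> g j \<le> g i" "\<And>i. i < p \<Longrightarrow> 0 \<le> g i"
    and l: "\<And>i j. i \<le> j \<Longrightarrow> j < n \<Longrightarrow> l j \<le> l i"
  obtains m w where "\<And>i j. i < p \<Longrightarrow> j < n \<Longrightarrow> g i * l j \<le> m i + w j"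
    "\<And>j. j < n \<Longrightarrow> 0 \<le> w j" "(\<Sum>i<p. m i) + (\<Sum>j<n. w j) = (\<Sum>i<p. g i * l i)"
proof -
  \<comment> \<open>Padding with zeros keeps the weights decreasing, as \<open>g\<close> is
    nonnegative, and makes \<open>w\<close> vanish from \<open>p\<close> on.\<close>
  define h where "h k = (if k < p then g k else 0)" for k
  have h: "h j \<le> h i" if "i \<le> j" for i j
    using that g by (auto simp: h_def)
  have h0: "0 \<le> h i" for i
    using g by (simp add: h_def)
  \<comment> \<open>Stopping before \<open>n - 1\<close> keeps \<open>Suc k\<close> below
    \<open>n\<close>, where \<open>l\<close> is known to decrease.\<close>
  define w where "w j = (\<Sum>k=j..<n-1. h k * (l k - l (Suc k)))" for j
  \<comment> \<open>Complementary slackness: the constraint is tight on the matched pairs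
    \<open>i = j\<close>.\<close>
  define m where "m i = g i * l i - w i" for i
  have lk: "0 \<le> l k - l (Suc k)" if "k < n - 1" for k
    using l[of k "Suc k"] that by simp
  have w0: "0 \<le> w j" for j
    unfolding w_def by (intro sum_nonneg mult_nonneg_nonneg h0 lk) simp
  have wz: "w j = 0" if "p \<le> j" for j
    unfolding w_def by (rule sum.neutral) (use that in \<open>simp add: h_def\<close>)
  have split: "w i = (\<Sum>k=i..<j. h k * (l k - l (Suc k))) + w j" if "i \<le> j" "j < n" for i j
    unfolding w_def by (rule sum.atLeastLessThan_concat[symmetric]) (use that in auto)
  have tel: "(\<Sum>k=i..<j. c * (l k - l (Suc k))) = c * (l i - l j)" if "i \<le> j" for i j c
    using sum_Suc_diff'[OF that, of "\<lambda>k. - l k"] by (simp flip: sum_distrib_left)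
  \<comment> \<open>The difference of \<open>w i\<close> and \<open>w j\<close> sums decrements of
    \<open>l\<close> between the two ranks. There the weights \<open>h k\<close> are at most
    \<open>h i\<close> if \<open>i \<le> j\<close> and at least \<open>h i\<close> otherwise; with
    constant weight \<open>h i\<close> the sum telescopes.\<close>
  have "g i * l j \<le> m i + w j" if "i < p" "j < n" for i j
  proof (cases "i \<le> j")
    case True
    have "(\<Sum>k=i..<j. h k * (l k - l (Suc k))) \<le> (\<Sum>k=i..<j. h i * (l k - l (Suc k)))"
      by (intro sum_mono mult_right_mono h lk) (use that in auto)
    also have "\<dots> = g i * (l i - l j)"
      using tel[OF True] that by (simp add: h_def)
    finally show ?thesis
      using split[OF True that(2)] by (simp add: m_def algebra_simps)
  next
    case False
    have "g i * (l j - l i) = (\<Sum>k=j..<i. h i * (l k - l (Suc k)))"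
      using tel[of j i] False that by (simp add: h_def)
    also have "\<dots> \<le> (\<Sum>k=j..<i. h k * (l k - l (Suc k)))"
      by (intro sum_mono mult_right_mono h lk) (use that assms(1) in auto)
    finally show ?thesis
      using split[of j i] False that assms(1) by (simp add: m_def algebra_simps)
  qed
  moreover have "(\<Sum>j<n. w j) = (\<Sum>j<p. w j)"
    by (rule sum.mono_neutral_right) (use assms(1) wz in auto)
  then have "(\<Sum>i<p. m i) + (\<Sum>j<n. w j) = (\<Sum>i<p. g i * l i)"
    by (simp add: m_def sum_subtractf)
  ultimately show thesis using that w0 by blast
qed

text \<open>Due to Anstreicher and Wolkowicz: without the multiplier \<open>W\<close> of the redundant constraint
  that \<open>mat 1 - X ** transpose X\<close> is positive semidefinite, a duality gap may remain.\<close>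

lemma stiefel_strong_duality:
  fixes C :: "real^'n^'n" and G :: "real^'p^'p"
  assumes card: "CARD('p) \<le> CARD('n)" and C: "sym_mat C" and G: "psd_mat G"
  obtains X :: "real^'p^'n" and M W where "transpose X ** X = mat 1" "sym_mat M" "psd_mat W"
    "\<And>Y :: real^'p^'n. trace_form G C Y - trace (M ** (transpose Y ** Y - mat 1))
       + trace (W ** (mat 1 - Y ** transpose Y)) \<le> trace_form G C X"
proof -
  note transpose_matrix_vector [simp del]
  obtain e :: "nat \<Rightarrow> real^'n" and l where e: "orthonormal_seq e"
    and ev: "\<And>i. i < CARD('n) \<Longrightarrow> C *v e i = l i *\<^sub>R e i"
    and l: "\<And>i j. i \<le> j \<Longrightarrow> j < CARD('n) \<Longrightarrow> l j \<le> l i"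
    using sym_mat_eigenbasis[OF C] by blast
  obtain f :: "nat \<Rightarrow> real^'p" and g where f: "orthonormal_seq f"
    and fv: "\<And>i. i < CARD('p) \<Longrightarrow> G *v f i = g i *\<^sub>R f i"
    and g: "\<And>i j. i \<le> j \<Longrightarrow> j < CARD('p) \<Longrightarrow> g j \<le> g i"
    using sym_mat_eigenbasis[of G] G unfolding psd_mat_def by blast
  have ee: "e i \<bullet> e j = (if i = j then 1 else 0)" if "i < CARD('n)" "j < CARD('n)" for i j
    using orthonormal_seqD[OF e] that by simp
  have ff: "f i \<bullet> f j = (if i = j then 1 else 0)" if "i < CARD('p)" "j < CARD('p)" for i j
    using orthonormal_seqD[OF f] that by simp
  have g0: "0 \<le> g i" if "i < CARD('p)" for i
    using psd_mat_eigenvalue_nonneg[OF G fv] ff that by simp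
  obtain m w where mw: "\<And>i j. i < CARD('p) \<Longrightarrow> j < CARD('n) \<Longrightarrow> g i * l j \<le> m i + w j"
    and w0: "\<And>j. j < CARD('n) \<Longrightarrow> 0 \<le> w j"
    and total: "(\<Sum>i<CARD('p). m i) + (\<Sum>j<CARD('n). w j) = (\<Sum>i<CARD('p). g i * l i)"
    using assignment_dual[of "CARD('p)" "CARD('n)" g l, OF card g g0 l] by blast
  obtain M where M: "sym_mat M" "\<And>i. i < CARD('p) \<Longrightarrow> M *v f i = m i *\<^sub>R f i"
    using ex_mat_eigenvalues[OF f] by metis
  obtain W where W: "psd_mat W" "\<And>i. i < CARD('n) \<Longrightarrow> W *v e i = w i *\<^sub>R e i"
    using ex_mat_eigenvalues[OF e, of w] w0 by metis
  \<comment> \<open>The optimal matching: the eigenvector of rank \<open>i\<close> of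
    \<open>G\<close> is sent to that of \<open>C\<close>, which is possible as
    \<open>CARD('p) \<le> CARD('n)\<close>.\<close>
  obtain X where X: "\<And>i. i < CARD('p) \<Longrightarrow> X *v f i = e i"
    using ex_matrix_orthonormal_seq[OF f] by metis
  have coordX: "(X *v x) \<bullet> e i = x \<bullet> f i" if "i < CARD('p)" for x i
  proof -
    have "X *v x = (\<Sum>j<CARD('p). (x \<bullet> f j) *\<^sub>R e j)"
      by (subst orthonormal_seq_expansion[OF f, of x]) (simp add: linear_sum[OF matrix_vector_mul_linear] matrix_vector_mult_scaleR X)
    also have "\<dots> \<bullet> e i = (\<Sum>j<CARD('p). if j = i then x \<bullet> f j else 0)"
      unfolding inner_sum_left by (rule sum.cong) (use that card ee in auto)
    finally show ?thesis using that by simp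
  qed
  have "transpose X ** X = mat 1"
  proof (rule matrix_eq[THEN iffD2], rule allI, rule orthonormal_seq_eqI[OF f])
    fix x i assume "i < DIM(real^'p)"
    then show "((transpose X ** X) *v x) \<bullet> f i = (mat 1 *v x) \<bullet> f i"
      by (simp add: matrix_vector_mul_assoc[symmetric] inner_transpose_mult X coordX inner_commute[of _ "f i"]
          inner_commute[of "e i"])
  qed
  moreover have "trace_form G C Y - trace (M ** (transpose Y ** Y - mat 1))
      + trace (W ** (mat 1 - Y ** transpose Y)) \<le> trace_form G C X" for Y :: "real^'p^'n"
  proof -
    \<comment> \<open>All three traces are affine in these squared coordinates, so the Lagrangian
      becomes that of the assignment problem with costs \<open>g i * l j\<close>.\<close>
    define a where "a i j = ((Y *v f i) \<bullet> e j)\<^sup>2" for i j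
    have "(Y *v f i) \<bullet> (C *v (Y *v f i)) = (\<Sum>j<CARD('n). l j * a i j)" for i
      by (subst inner_orthonormal_seq[OF e])
        (simp add: sym_mat_inner[OF C] ev a_def power2_eq_square ac_simps)
    then have 1: "trace_form G C Y = (\<Sum>i<CARD('p). \<Sum>j<CARD('n). g i * l j * a i j)"
      by (simp add: trace_form_eigenbasis[OF f fv] sum_distrib_left mult.assoc)
    have "f i \<bullet> ((transpose Y ** Y - mat 1) *v f i) = (\<Sum>j<CARD('n). a i j) - 1"
      if "i < CARD('p)" for i
      by (simp add: matrix_vector_mult_diff_rdistrib inner_diff_right ff that
          matrix_vector_mul_assoc[symmetric] inner_transpose_mult)
        (subst inner_orthonormal_seq[OF e], simp add: a_def power2_eq_square)
    then have 2: "trace (M ** (transpose Y ** Y - mat 1)) =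
        (\<Sum>i<CARD('p). \<Sum>j<CARD('n). m i * a i j) - (\<Sum>i<CARD('p). m i)"
      by (simp add: trace_eigenbasis[OF f M(2)] sum_distrib_left right_diff_distrib sum_subtractf)
    have "e j \<bullet> ((mat 1 - Y ** transpose Y) *v e j) = 1 - (\<Sum>i<CARD('p). a i j)"
      if "j < CARD('n)" for j
    proof -
      have "e j \<bullet> (Y *v (transpose Y *v e j)) = (transpose Y *v e j) \<bullet> (transpose Y *v e j)"
        by (simp add: inner_transpose_mult inner_commute)
      also have "\<dots> = (\<Sum>i<CARD('p). a i j)"
        by (subst inner_orthonormal_seq[OF f])
          (simp add: a_def power2_eq_square inner_commute[of "transpose Y *v _"] inner_transpose_mult)
      finally show ?thesis
        by (simp add: matrix_vector_mult_diff_rdistrib inner_diff_right ee that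
            matrix_vector_mul_assoc[symmetric])
    qed
    then have "trace (W ** (mat 1 - Y ** transpose Y)) =
        (\<Sum>j<CARD('n). w j) - (\<Sum>j<CARD('n). \<Sum>i<CARD('p). w j * a i j)"
      by (simp add: trace_eigenbasis[OF e W(2)] sum_distrib_left right_diff_distrib sum_subtractf)
    then have 3: "trace (W ** (mat 1 - Y ** transpose Y)) =
        (\<Sum>j<CARD('n). w j) - (\<Sum>i<CARD('p). \<Sum>j<CARD('n). w j * a i j)"
      by (simp only: sum.swap[of "\<lambda>j i. w j * a i j" "{..<CARD('p)}"])
    \<comment> \<open>As \<open>a i j\<close> is nonnegative, dual feasibility \<open>mw\<close>
      bounds the part linear in \<open>a\<close> by zero; the constant left over is
      \<open>total\<close>, the value at \<open>X\<close>.\<close>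
    have "(\<Sum>i<CARD('p). \<Sum>j<CARD('n). g i * l j * a i j) \<le>
        (\<Sum>i<CARD('p). \<Sum>j<CARD('n). m i * a i j + w j * a i j)"
      by (intro sum_mono) (use mw in \<open>auto simp: a_def mult_right_mono simp flip: distrib_right\<close>)
    moreover have "trace_form G C X = (\<Sum>i<CARD('p). g i * l i)"
      using card by (simp add: trace_form_eigenbasis[OF f fv] X ev ee)
    ultimately show ?thesis
      using 1 2 3 total by (simp add: sum.distrib)
  qed
  ultimately show thesis using that M(1) W(1) by blast
qed

section \<open>Positivity of the denominator and the feasible set\<close>

lemma matrix_diff_ldistrib:
  fixes A :: "'a::ring_1^'m^'n"
  shows "A ** (B - C) = A ** B - A ** C"
  by (simp add: vec_eq_iff matrix_matrix_mult_def right_diff_distrib sum_subtractf)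

lemma matrix_diff_rdistrib:
  fixes A :: "'a::ring_1^'m^'n"
  shows "(A - B) ** C = A ** C - B ** C"
  by (simp add: vec_eq_iff matrix_matrix_mult_def left_diff_distrib sum_subtractf)

text \<open>For Dinkelbach's reduction: with a positive denominator, the ratio is at most
  \<open>c\<close> exactly when this form is at most 0.\<close>

lemma trace_form_diff_scaleR:
  "trace_form G (B - c *\<^sub>R A) X = trace_form G B X - c * trace_form G A X"
proof -
  have *: "trace (c *\<^sub>R Q) = c * trace Q" for Q :: "real^'k^'k"
    by (simp add: trace_def sum_distrib_left)
  have "G ** transpose X ** (B - c *\<^sub>R A) ** X =
      G ** transpose X ** B ** X - c *\<^sub>R (G ** transpose X ** A ** X)"
    by (simp add: matrix_diff_ldistrib matrix_diff_rdistrib matrix_scalar_ac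
        scalar_matrix_assoc matrix_mul_assoc)
  then show ?thesis
    by (simp add: trace_form_def trace_sub *)
qed

lemma pd_mat_imp_psd_mat: "pd_mat A \<Longrightarrow> psd_mat A"
  unfolding pd_mat_def psd_mat_def by (metis inner_zero_left less_eq_real_def)

text \<open>In an eigenbasis of \<open>G\<close> this is a sum of nonnegative terms, and some
  \<open>X *v f i\<close> is nonzero because the \<open>f i\<close> span.\<close>

lemma trace_form_pos:
  fixes G :: "real^'p^'p" and A :: "real^'n^'n"
  assumes G: "pd_mat G" and A: "pd_mat A" and "X \<noteq> 0"
  shows "0 < trace_form G A X"
proof -
  obtain f :: "nat \<Rightarrow> real^'p" and g where f: "orthonormal_seq f"
    and fv: "\<And>i. i < CARD('p) \<Longrightarrow> G *v f i = g i *\<^sub>R f i"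
    using sym_mat_eigenbasis[of G] G unfolding pd_mat_def by metis
  have gpos: "0 < g i" if "i < CARD('p)" for i
  proof -
    have "f i \<bullet> f i = 1" using orthonormal_seqD[OF f] that by simp
    moreover then have "f i \<noteq> 0" by auto
    ultimately show ?thesis
      using G fv[OF that] unfolding pd_mat_def by (metis inner_scaleR_right mult.right_neutral)
  qed
  have "\<exists>i<CARD('p). X *v f i \<noteq> 0"
  proof (rule ccontr)
    assume "\<not> ?thesis"
    then have "X *v x = 0" for x
      by (subst orthonormal_seq_expansion[OF f, of x]) (simp add: linear_sum[OF matrix_vector_mul_linear] matrix_vector_mult_scaleR)
    then have "X = 0" by (simp add: matrix_eq)
    then show False using assms by simp
  qed
  then obtain i where "i < CARD('p)" "X *v f i \<noteq> 0" by blast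
  then have "0 < (\<Sum>i<CARD('p). g i * ((X *v f i) \<bullet> (A *v (X *v f i))))"
    using A gpos pd_mat_imp_psd_mat[OF A] unfolding pd_mat_def psd_mat_def
    by (intro sum_pos2[of _ i]) (auto intro: mult_nonneg_nonneg less_imp_le)
  then show ?thesis
    by (simp add: trace_form_eigenbasis[OF f fv])
qed

lemma trace_psd_mult_nonneg:
  fixes W N :: "real^'n^'n"
  assumes W: "psd_mat W" and N: "psd_mat N"
  shows "0 \<le> trace (W ** N)"
proof -
  obtain e :: "nat \<Rightarrow> real^'n" and w where e: "orthonormal_seq e"
    and ev: "\<And>i. i < CARD('n) \<Longrightarrow> W *v e i = w i *\<^sub>R e i"
    using sym_mat_eigenbasis[of W] W unfolding psd_mat_def by metis
  have "0 \<le> w i" if "i < CARD('n)" for i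
    using psd_mat_eigenvalue_nonneg[OF W ev] orthonormal_seqD[OF e] that by simp
  then show ?thesis
    using N by (auto intro!: sum_nonneg simp: trace_eigenbasis[OF e ev] psd_mat_def)
qed

text \<open>This matrix is the orthogonal projection onto the complement of the column space of
  \<open>X\<close>; for a symmetric idempotent the quadratic form is a squared norm.\<close>

lemma psd_mat_stiefel:
  fixes X :: "real^'p^'n"
  assumes "transpose X ** X = mat 1"
  shows "psd_mat (mat 1 - X ** transpose X)"
proof -
  define P where "P = mat 1 - X ** transpose X"
  have sym: "sym_mat P"
    by (simp add: P_def sym_mat_def transpose_def vec_eq_iff matrix_matrix_mult_def mat_def
        mult.commute)
  have "X ** transpose X ** (X ** transpose X) = X ** (transpose X ** X) ** transpose X"
    by (simp add: matrix_mul_assoc)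
  then have "P ** P = P"
    by (simp add: P_def matrix_diff_ldistrib matrix_diff_rdistrib assms)
  then have "x \<bullet> (P *v x) = (P *v x) \<bullet> (P *v x)" for x
    by (metis matrix_vector_mul_assoc sym sym_mat_inner)
  then show ?thesis
    using sym unfolding psd_mat_def P_def by (metis inner_ge_zero)
qed

text \<open>The positive denominator cancels, and orthonormal columns imply the Loewner inequality
  by \<open>psd_mat_stiefel\<close>.\<close>

lemma grs_feasible_iff:
  fixes G :: "real^'p^'p" and A :: "real^'n^'n"
  assumes "pd_mat G" "pd_mat A"
  shows "X \<in> grs_feasible G A \<longleftrightarrow> transpose X ** X = mat 1"
proof
  assume "X \<in> grs_feasible G A"
  then show "transpose X ** X = mat 1"
    using trace_form_pos[OF assms, of X] by (auto simp: grs_feasible_def)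
next
  assume X: "transpose X ** X = mat 1"
  have "X \<noteq> 0"
  proof
    assume "X = 0"
    then have "(mat 1 :: real^'p^'p) = 0"
      using X by (simp add: matrix_matrix_mult_def zero_vec_def)
    \<comment> \<open>\<open>undefined\<close> is just some index: types are nonempty, which encodes
      that \<open>p\<close> is at least 1.\<close>
    then have "(mat 1 :: real^'p^'p) $ undefined $ undefined = 0"
      by simp
    then show False by (simp add: mat_def)
  qed
  moreover have "psd_mat (c *\<^sub>R (mat 1 - X ** transpose X))" if "0 \<le> c" for c
    using psd_mat_stiefel[OF X] that
    by (auto simp: psd_mat_def sym_mat_def transpose_scalar scaleR_matrix_vector_assoc[symmetric])
  ultimately show "X \<in> grs_feasible G A"
    using X trace_form_pos[OF assms, of X]
    by (simp add: grs_feasible_def loewner_le_def flip: scaleR_diff_right)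
qed

section \<open>Weak and strong duality for the fractional problem\<close>

theorem theorem3:
  fixes B A :: "real^'n^'n" and G :: "real^'p^'p"
  assumes "CARD('p) \<le> CARD('n)"
    and "sym_mat B" and "pd_mat G" and "pd_mat A"
  shows "grs_value B G A = grs_dual_value B G A"
proof (rule antisym)
  note feas = grs_feasible_iff[OF assms(3,4)] and pos = trace_form_pos[OF assms(3,4)]
  have "ereal (trace_form G B X / trace_form G A X) \<le> grs_dual_fun B G A M W"
    if X: "X \<in> grs_feasible G A" and W: "psd_mat W" for X :: "real^'p^'n" and M W
  proof -
    have "X \<noteq> 0" and XX: "transpose X ** X = mat 1"
      using X feas by (auto simp: grs_feasible_def)
    have "0 \<le> trace (W ** (mat 1 - X ** transpose X))"
      by (rule trace_psd_mult_nonneg[OF W psd_mat_stiefel[OF XX]])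
    \<comment> \<open>At a feasible point the \<open>M\<close> term vanishes and the
      \<open>W\<close> term only adds.\<close>
    then have "trace_form G B X / trace_form G A X \<le> grs_lagrangian B G A M W X"
      using pos[OF \<open>X \<noteq> 0\<close>]
      by (simp add: grs_lagrangian_def XX trace_0[unfolded mat_0] divide_right_mono)
    then show ?thesis
      unfolding grs_dual_fun_def using \<open>X \<noteq> 0\<close> by (auto intro: SUP_upper2)
  qed
  then show "grs_value B G A \<le> grs_dual_value B G A"
    unfolding grs_value_def grs_dual_value_def by (auto intro!: SUP_least INF_greatest)
  show "grs_dual_value B G A \<le> grs_value B G A"
  proof (cases "grs_value B G A")
    case (real v)
    have "sym_mat (B - v *\<^sub>R A)"
      using assms(2,4) by (simp add: pd_mat_def sym_mat_def transpose_def vec_eq_iff)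
    then obtain X :: "real^'p^'n" and M W where X: "transpose X ** X = mat 1"
      and M: "sym_mat M" and W: "psd_mat W"
      and dual: "\<And>Y :: real^'p^'n. trace_form G (B - v *\<^sub>R A) Y
        - trace (M ** (transpose Y ** Y - mat 1)) + trace (W ** (mat 1 - Y ** transpose Y))
        \<le> trace_form G (B - v *\<^sub>R A) X"
      using stiefel_strong_duality[OF assms(1) _ pd_mat_imp_psd_mat[OF assms(3)]] by metis
    have "X \<in> grs_feasible G A" "X \<noteq> 0"
      using X feas by (auto simp: grs_feasible_def)
    \<comment> \<open>The maximiser of the trace problem is feasible for (GRS), so its ratio is at
      most \<open>v\<close> and the trace maximum at most 0.\<close>
    then have "ereal (trace_form G B X / trace_form G A X) \<le> ereal v"
      unfolding real[symmetric] grs_value_def by (intro SUP_upper)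
    then have le0: "trace_form G (B - v *\<^sub>R A) X \<le> 0"
      using pos[OF \<open>X \<noteq> 0\<close>] by (simp add: trace_form_diff_scaleR field_simps)
    \<comment> \<open>Adding \<open>v * trace_form G A Y\<close> and dividing by the positive
      denominator turns the bound \<open>dual\<close> into one on the fractional Lagrangian, with
      the same \<open>M\<close> and \<open>W\<close>.\<close>
    have "grs_lagrangian B G A M W Y \<le> v" if "Y \<noteq> 0" for Y :: "real^'p^'n"
      using order_trans[OF dual[of Y] le0] pos[OF that]
      by (simp add: grs_lagrangian_def trace_form_diff_scaleR field_simps)
    then have "grs_dual_fun B G A M W \<le> v"
      unfolding grs_dual_fun_def by (auto intro!: SUP_least)
    then show ?thesis
      unfolding real grs_dual_value_def using M W by (auto intro!: INF_lower2)
  next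
    \<comment> \<open>Impossible, as a feasible point exists; the duality lemma is used only to
      produce one. For the value \<infinity> the inequality is trivial.\<close>
    case MInf
    obtain X :: "real^'p^'n" where "transpose X ** X = mat 1"
      using stiefel_strong_duality[OF assms(1,2) pd_mat_imp_psd_mat[OF assms(3)]] by metis
    then have "ereal (trace_form G B X / trace_form G A X) \<le> grs_value B G A"
      unfolding grs_value_def using feas by (intro SUP_upper) auto
    with MInf show ?thesis by simp
  qed simp
qed

end
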